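(* Let $L,L'$ be two generic distinct lines in $\mathbb{P}^3$, and let $X\subseteq L$ and $X'\subseteq L'$ be generic finite sets of points with $|X|=|X'|=m\ge 2$. Then $X\star X'$ is not a complete intersection. Precisely: there is a nonempty Zariski open subset $W$ of the variety of pairs of lines in $\mathbb{P}^3$ such that for every $(L,L')\in W$ with $L\neq L'$ there is a nonempty Zariski open subset $U\subseteq L$ such that for every finite set $X\subseteq U$ with $|X|\ge2$ there is a nonempty Zariski open subset $U'\subseteq L'$ such that for every finite set $X'\subseteq U'$ with $|X'|=|X|=m$ the set $X\star X'$ is not a complete intersection.
   Context: Work over an algebraically closed field $\mathbb{K}$. For points $P=[p_0:\dots:p_3]$, $Q=[q_0:\dots:q_3]$ of $\mathbb{P}^3$, the Hadamard product is $P\star Q=[p_0q_0:\dots:p_3q_3]$, defined when not all $p_iq_i$ vanish. For finite sets $X,X'\subseteq\mathbb{P}^3$, $X\star X'$ is the finite set of all defined products $P\star P'$ with $P\in X$, $P'\in X'$. The variety of pairs of lines is $G\times G$, where $G$ is the Grassmannian of lines in $\mathbb{P}^3$. A finite set $Z$ of points of $\mathbb{P}^n$ is a complete intersection if its (radical homogeneous) ideal $I_Z\subseteq\mathbb{K}[x_0,\dots,x_n]$ is generated by $n$ forms; here $n=3$. *)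

theory Defs
  imports
    "HOL-Analysis.Analysis"
    "HOL-Library.Poly_Mapping"
    "HOL-Computational_Algebra.Polynomial"
begin

text \<open>Polynomials over \<open>'k\<close> in variables indexed by \<open>'i\<close>, with the ring structure of
  \<^theory>\<open>HOL-Library.Poly_Mapping\<close>.\<close>

type_synonym ('i, 'k) mpoly = "('i \<Rightarrow>\<^sub>0 nat) \<Rightarrow>\<^sub>0 'k"

definition mpoly_eval :: "('i::finite, 'k::comm_ring_1) mpoly \<Rightarrow> ('i \<Rightarrow> 'k) \<Rightarrow> 'k" where
  "mpoly_eval f x =
     (\<Sum>m\<in>Poly_Mapping.keys f.
        Poly_Mapping.lookup f m * (\<Prod>i\<in>UNIV. x i ^ Poly_Mapping.lookup m i))"

text \<open>The zero polynomial counts as a form (of every degree).\<close>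

definition form :: "('i::finite, 'k::comm_ring_1) mpoly \<Rightarrow> bool" where
  "form f \<longleftrightarrow>
     (\<exists>d. \<forall>m\<in>Poly_Mapping.keys f. (\<Sum>i\<in>UNIV. Poly_Mapping.lookup m i) = d)"

definition biform :: "('i::finite + 'j::finite, 'k::comm_ring_1) mpoly \<Rightarrow> bool" where
  "biform f \<longleftrightarrow>
     (\<exists>d e. \<forall>m\<in>Poly_Mapping.keys f.
        (\<Sum>i\<in>UNIV. Poly_Mapping.lookup m (Inl i)) = d \<and>
        (\<Sum>j\<in>UNIV. Poly_Mapping.lookup m (Inr j)) = e)"

definition ideal_generated :: "'a::comm_ring_1 set \<Rightarrow> 'a set" where
  "ideal_generated B = module.span (*) B"

text \<open>A point of the projective space with homogeneous coordinates indexed by \<open>'n\<close> (so of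
  dimension \<open>CARD('n) - 1\<close>) is the set of all its homogeneous coordinate vectors.\<close>

type_synonym ('k, 'n) ppoint = "('k ^ 'n) set"

definition ppoint :: "'k::field ^ 'n \<Rightarrow> ('k, 'n) ppoint" where
  "ppoint v = {c *s v | c. c \<noteq> 0}"

definition pspace :: "('k::field, 'n::finite) ppoint set" where
  "pspace = {ppoint v | v. v \<noteq> 0}"

text \<open>The topology is generated by the complements of hypersurfaces. As
  \<open>D(f) \<inter> D(g) = D(fg)\<close>, these are closed under finite intersection, so the closed sets are
  exactly the common zero sets of families of forms.\<close>

definition zariski :: "('k::field, 'n::finite) ppoint topology" where
  "zariski = topology_generated_by
     {{P \<in> pspace. \<forall>p\<in>P. mpoly_eval f (($) p) \<noteq> 0} | f. form f}"

text \<open>The Zariski topology on a product of two projective spaces (not the product topology):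
  the closed sets are the common zero sets of families of bihomogeneous polynomials.\<close>

definition zariski_prod ::
  "(('k::field, 'n::finite) ppoint \<times> ('k, 'm::finite) ppoint) topology" where
  "zariski_prod = topology_generated_by
     {{(P, Q) \<in> pspace \<times> pspace.
         \<forall>p\<in>P. \<forall>q\<in>Q. mpoly_eval f (case_sum (($) p) (($) q)) \<noteq> 0} | f. biform f}"

definition plines :: "('k::field, 'n::finite) ppoint set set" where
  "plines = {{ppoint v | v. v \<in> V \<and> v \<noteq> 0} | V. vec.subspace V \<and> vec.dim V = 2}"

text \<open>All coordinates \<open>p\<^sub>i\<^sub>j = a\<^sub>i b\<^sub>j - a\<^sub>j b\<^sub>i\<close> are kept; those
  with \<open>i \<ge> j\<close> are zero or negatives of the ones with \<open>i < j\<close>, so the induced topology is the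
  usual one.\<close>

definition wedge :: "'k::field ^ 'n \<Rightarrow> 'k ^ 'n \<Rightarrow> 'k ^ ('n \<times> 'n)" where
  "wedge a b = (\<chi> ij. a $ fst ij * b $ snd ij - a $ snd ij * b $ fst ij)"

text \<open>A change of basis multiplies \<^const>\<open>wedge\<close> by its determinant, so letting
  the pair of spanning points and their coordinate vectors vary yields exactly one projective
  point.\<close>

definition plucker :: "('k::field, 'n::finite) ppoint set \<Rightarrow> ('k, 'n \<times> 'n) ppoint" where
  "plucker L = {wedge a b | a b. a \<in> \<Union>L \<and> b \<in> \<Union>L \<and> ppoint a \<noteq> ppoint b}"

text \<open>The variety \<open>G \<times> G\<close> of pairs of lines, as a subvariety of a product of two projective
  spaces under the Pluecker embedding of each factor.\<close>

definition zariski_line_pairs ::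
  "(('k::field, 'n::finite) ppoint set \<times> ('k, 'n) ppoint set) topology" where
  "zariski_line_pairs =
     pullback_topology (plines \<times> plines) (map_prod plucker plucker) zariski_prod"

text \<open>The product \<open>p * q\<close> of vectors is componentwise; undefined point products are left out.\<close>

definition hadamard ::
  "('k::field, 'n::finite) ppoint set \<Rightarrow> ('k, 'n) ppoint set \<Rightarrow> ('k, 'n) ppoint set"
  (infixl "\<star>" 70) where
  "X \<star> X' = {ppoint (p * q) | p q. p \<in> \<Union>X \<and> q \<in> \<Union>X' \<and> p * q \<noteq> 0}"

definition vanishing_ideal :: "('k::field, 'n::finite) ppoint set \<Rightarrow> ('n, 'k) mpoly set" where
  "vanishing_ideal Z =
     ideal_generated {f. form f \<and> (\<forall>P\<in>Z. \<forall>p\<in>P. mpoly_eval f (($) p) = 0)}"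

text \<open>Only meant for finite sets of points: then the codimension is \<open>CARD('n) - 1\<close>, the
  dimension of the projective space.\<close>

definition complete_intersection :: "('k::field, 'n::finite) ppoint set \<Rightarrow> bool" where
  "complete_intersection Z \<longleftrightarrow>
     (\<exists>g :: nat \<Rightarrow> ('n, 'k) mpoly.
        (\<forall>i < CARD('n) - 1. form (g i)) \<and>
        vanishing_ideal Z = ideal_generated (g ` {..< CARD('n) - 1}))"

end

theory Submission
  imports Defs
begin

text \<open>
  For a generic pair of lines, with coordinate pairs \<open>s\<close> and \<open>t\<close>, the products \<open>p * q\<close> of their
  points sweep out a smooth quadric: the four bilinear forms \<open>p\<^sub>i q\<^sub>i\<close> are linearly independent, so
  after a linear change of coordinates \<open>(s, t) \<mapsto> p * q\<close> is the Segre embedding of the product of the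
  lines. The exceptional pairs are those for which the four points of intersection with the coordinate
  planes have the same cross ratio on both lines, together with some degenerate ones; they are the zeros of a
  form of bidegree \<open>(2, 2)\<close> in the Pluecker coordinates, whose complement is the open set \<open>W\<close>
  (\<open>cross_ratio_form\<close>, \<open>separates_lines_if_generic\<close>). On these pairs, \<open>U = L\<close> and
  \<open>U' = L'\<close> will do, and \<open>X \<star> X'\<close> is an \<open>m \<times> m\<close> grid on the quadric.

  Forms of degree less than \<open>m\<close> that vanish on the grid vanish on the quadric
  (\<open>grid_form_eq_0\<close>). Therefore, if forms generate the ideal of the grid, the restriction to the
  quadric of an element of degree \<open>m\<close> is a linear combination, with constant coefficients, of the
  restrictions of the generators of degree \<open>m\<close> (\<open>degree_component_of_combination\<close>); the
  number of generators is at least the dimension of the space of these restrictions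
  (\<open>card_generators_ge\<close>). But this dimension is at least \<open>4\<close> if
  \<open>m \<ge> 2\<close>, as shown by four explicit products of planes (\<open>dual_grid_forms\<close>), and
  a complete intersection has only three generators.
\<close>

section \<open>Evaluation of forms\<close>

definition monomial_eval :: "('i::finite \<Rightarrow>\<^sub>0 nat) \<Rightarrow> ('i \<Rightarrow> 'k::comm_ring_1) \<Rightarrow> 'k" where
  "monomial_eval m x = (\<Prod>i\<in>UNIV. x i ^ Poly_Mapping.lookup m i)"

lemma monomial_eval_add: "monomial_eval (m + n) x = monomial_eval m x * monomial_eval n x"
  by (simp add: monomial_eval_def lookup_add power_add prod.distrib)

lemma mpoly_eval_superset:
  assumes "finite A" "Poly_Mapping.keys f \<subseteq> A"
  shows "mpoly_eval f x = (\<Sum>m\<in>A. Poly_Mapping.lookup f m * monomial_eval m x)"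
  unfolding mpoly_eval_def monomial_eval_def
  by (rule sum.mono_neutral_left) (use assms in \<open>auto simp: in_keys_iff\<close>)

lemma mpoly_eval_0 [simp]: "mpoly_eval 0 x = 0"
  by (simp add: mpoly_eval_def)

lemma mpoly_eval_add: "mpoly_eval (f + g) x = mpoly_eval f x + mpoly_eval g x"
proof -
  let ?A = "Poly_Mapping.keys f \<union> Poly_Mapping.keys g"
  have "mpoly_eval (f + g) x = (\<Sum>m\<in>?A. Poly_Mapping.lookup (f + g) m * monomial_eval m x)"
    by (intro mpoly_eval_superset) (use keys_add[of f g] in auto)
  also have "\<dots> = mpoly_eval f x + mpoly_eval g x"
    by (subst (1 2) mpoly_eval_superset[of ?A])
       (auto simp: lookup_add distrib_right sum.distrib)
  finally show ?thesis .
qed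

lemma mpoly_eval_sum: "mpoly_eval (\<Sum>i\<in>I. f i) x = (\<Sum>i\<in>I. mpoly_eval (f i) x)"
  by (induction I rule: infinite_finite_induct) (auto simp: mpoly_eval_add)

lemma mpoly_eval_single: "mpoly_eval (Poly_Mapping.single m c) x = c * monomial_eval m x"
  by (subst mpoly_eval_superset[of "{m}"]) auto

lemma mpoly_as_sum_of_monomials:
  "f = (\<Sum>m\<in>Poly_Mapping.keys f. Poly_Mapping.single m (Poly_Mapping.lookup f m))"
  by (rule poly_mapping_eqI)
     (auto simp: lookup_sum lookup_single when_def in_keys_iff sum.delta)

lemma mpoly_eval_mult: "mpoly_eval (f * g) x = mpoly_eval f x * mpoly_eval g x"
proof -
  let ?s = "\<lambda>f m. Poly_Mapping.single m (Poly_Mapping.lookup f m)"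
  have "f * g = (\<Sum>m\<in>Poly_Mapping.keys f. \<Sum>n\<in>Poly_Mapping.keys g. ?s f m * ?s g n)"
    using arg_cong2[OF mpoly_as_sum_of_monomials[of f] mpoly_as_sum_of_monomials[of g], of "(*)"]
    by (simp only: sum_product)
  then have "mpoly_eval (f * g) x =
      (\<Sum>m\<in>Poly_Mapping.keys f. \<Sum>n\<in>Poly_Mapping.keys g.
        (Poly_Mapping.lookup f m * monomial_eval m x) *
        (Poly_Mapping.lookup g n * monomial_eval n x))"
    by (simp add: mpoly_eval_sum mult_single mpoly_eval_single monomial_eval_add ac_simps)
  also have "\<dots> = mpoly_eval f x * mpoly_eval g x"
    by (simp add: mpoly_eval_superset[OF finite_keys order_refl] sum_product)
  finally show ?thesis .
qed

lemma mpoly_eval_diff: "mpoly_eval (f - g) x = mpoly_eval f x - mpoly_eval g x"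
  using mpoly_eval_add[of "f - g" g x] by (simp add: algebra_simps)

lemma mpoly_eval_1 [simp]: "mpoly_eval 1 x = 1"
  unfolding single_one[symmetric] mpoly_eval_single by (simp add: monomial_eval_def)

text \<open>The degree is a parameter here because it has to be compared with the number of points; the
  zero polynomial is homogeneous of every degree.\<close>

definition homogeneous :: "nat \<Rightarrow> ('i::finite, 'k::comm_ring_1) mpoly \<Rightarrow> bool" where
  "homogeneous d f \<longleftrightarrow>
     (\<forall>m\<in>Poly_Mapping.keys f. (\<Sum>i\<in>UNIV. Poly_Mapping.lookup m i) = d)"

lemma form_iff_homogeneous: "form f \<longleftrightarrow> (\<exists>d. homogeneous d f)"
  by (simp add: form_def homogeneous_def)

lemma homogeneous_1: "homogeneous 0 1"
  unfolding single_one[symmetric] homogeneous_def by simp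

lemma homogeneous_mult:
  assumes "homogeneous d f" "homogeneous e g"
  shows "homogeneous (d + e) (f * g)"
  unfolding homogeneous_def
proof
  fix m assume "m \<in> Poly_Mapping.keys (f * g)"
  then obtain a b where "m = a + b" "a \<in> Poly_Mapping.keys f" "b \<in> Poly_Mapping.keys g"
    using keys_mult[of f g] by auto
  then show "(\<Sum>i\<in>UNIV. Poly_Mapping.lookup m i) = d + e"
    using assms by (simp add: homogeneous_def lookup_add sum.distrib)
qed

lemma homogeneous_prod:
  assumes "\<And>i. i \<in> I \<Longrightarrow> homogeneous 1 (f i)" "finite I"
  shows "homogeneous (card I) (\<Prod>i\<in>I. f i)"
  using assms(2,1)
proof (induction I rule: finite_induct)
  case (insert i I)
  then show ?case using homogeneous_mult[of 1 "f i" "card I" "\<Prod>i\<in>I. f i"] by simp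
qed (simp add: homogeneous_1)

lemma mpoly_eval_prod: "mpoly_eval (\<Prod>i\<in>I. f i) x = (\<Prod>i\<in>I. mpoly_eval (f i) x)"
  by (induction I rule: infinite_finite_induct) (auto simp: mpoly_eval_mult)

lemma monomial_eval_single: "monomial_eval (Poly_Mapping.single i 1) x = x i"
proof -
  have "monomial_eval (Poly_Mapping.single i 1) x = (\<Prod>j\<in>UNIV. if j = i then x j else 1)"
    unfolding monomial_eval_def by (rule prod.cong) (auto simp: lookup_single when_def)
  then show ?thesis by simp
qed

lemma linear_form_exists:
  fixes c :: "'n::finite \<Rightarrow> 'k::comm_ring_1"
  shows "\<exists>h. homogeneous 1 h \<and> (\<forall>x. mpoly_eval h x = (\<Sum>i\<in>UNIV. c i * x i))"
proof (intro exI conjI allI)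
  let ?h = "\<Sum>i\<in>UNIV. Poly_Mapping.single (Poly_Mapping.single i (1::nat)) (c i)"
  show "homogeneous 1 ?h"
    unfolding homogeneous_def
  proof
    fix m assume "m \<in> Poly_Mapping.keys ?h"
    then obtain j where "m \<in> Poly_Mapping.keys (Poly_Mapping.single (Poly_Mapping.single j (1::nat)) (c j))"
      using keys_sum[of "\<lambda>i. Poly_Mapping.single (Poly_Mapping.single i (1::nat)) (c i)" UNIV] by blast
    then have "m = Poly_Mapping.single j 1" by (auto split: if_splits)
    then show "(\<Sum>i\<in>UNIV. Poly_Mapping.lookup m i) = 1"
      by (simp add: lookup_single when_def)
  qed
  show "mpoly_eval ?h x = (\<Sum>i\<in>UNIV. c i * x i)" for x
    by (simp only: mpoly_eval_sum mpoly_eval_single monomial_eval_single)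
qed

lemma homogeneous_scale:
  fixes p :: "'k::field ^ 'n::finite"
  assumes "homogeneous d f"
  shows "mpoly_eval f (($) (c *s p)) = c ^ d * mpoly_eval f (($) p)"
proof -
  have "Poly_Mapping.lookup f m * (\<Prod>i\<in>UNIV. (c * p $ i) ^ Poly_Mapping.lookup m i) =
      c ^ d * (Poly_Mapping.lookup f m * (\<Prod>i\<in>UNIV. p $ i ^ Poly_Mapping.lookup m i))"
    if "m \<in> Poly_Mapping.keys f" for m
    using that assms by (simp add: homogeneous_def power_mult_distrib prod.distrib flip: power_sum)
  then show ?thesis
    unfolding mpoly_eval_def sum_distrib_left vector_smult_component by (rule sum.cong[OF refl])
qed

text \<open>Restriction to an affine line turns questions about forms into questions about polynomials in
  one variable, where a nonzero polynomial has at most as many roots as its degree says.\<close>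

lemma mpoly_eval_along_line:
  fixes p q :: "'k::field ^ 'n::finite"
  shows "\<exists>P. \<forall>c. poly P c = mpoly_eval f (($) (p + c *s q))"
    and "homogeneous d f \<Longrightarrow>
      \<exists>P. degree P \<le> d \<and> (\<forall>c. poly P c = mpoly_eval f (($) (p + c *s q)))"
proof -
  define P where "P = (\<Sum>m\<in>Poly_Mapping.keys f.
    smult (Poly_Mapping.lookup f m) (\<Prod>i\<in>UNIV. [:p $ i, q $ i:] ^ Poly_Mapping.lookup m i))"
  have P: "poly P c = mpoly_eval f (($) (p + c *s q))" for c
    by (simp add: P_def mpoly_eval_def poly_sum poly_prod poly_power)
  then show "\<exists>P. \<forall>c. poly P c = mpoly_eval f (($) (p + c *s q))" by blast
  assume hom: "homogeneous d f"
  have "degree P \<le> d"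
    unfolding P_def
  proof (rule degree_sum_le)
    fix m assume m: "m \<in> Poly_Mapping.keys f"
    have "degree (\<Prod>i\<in>UNIV. [:p $ i, q $ i:] ^ Poly_Mapping.lookup m i)
        \<le> (\<Sum>i\<in>UNIV. degree ([:p $ i, q $ i:] ^ Poly_Mapping.lookup m i))"
      using degree_prod_sum_le[of UNIV "\<lambda>i. [:p $ i, q $ i:] ^ Poly_Mapping.lookup m i"]
      by (simp add: o_def)
    also have "\<dots> \<le> (\<Sum>i\<in>UNIV. Poly_Mapping.lookup m i)"
      by (intro sum_mono order_trans[OF degree_power_le]) simp
    also have "\<dots> = d" using hom m by (simp add: homogeneous_def)
    finally show "degree (smult (Poly_Mapping.lookup f m)
        (\<Prod>i\<in>UNIV. [:p $ i, q $ i:] ^ Poly_Mapping.lookup m i)) \<le> d"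
      using degree_smult_le order_trans by blast
  qed simp
  with P show "\<exists>P. degree P \<le> d \<and> (\<forall>c. poly P c = mpoly_eval f (($) (p + c *s q)))" by blast
qed

section \<open>A lower bound for the number of generators\<close>

lemma infinite_UNIV_alg_closed: "infinite (UNIV :: 'k::alg_closed_field set)"
proof
  assume fin: "finite (UNIV :: 'k set)"
  \<comment> \<open>If the field were finite, this polynomial would vanish at
      all of its elements, and adding \<open>1\<close> would give a polynomial without roots.\<close>
  define p where "p = (\<Prod>a\<in>(UNIV::'k set). [:-a, 1:])"
  have deg: "degree p = card (UNIV :: 'k set)"
    unfolding p_def by (subst degree_prod_eq_sum_degree) auto
  have "degree (p + 1) = degree p"
    by (rule degree_add_eq_left) (use deg fin finite_UNIV_card_ge_0 in auto)
  then obtain x where "poly (p + 1) x = 0"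
    using alg_closed_imp_poly_has_root[of "p + 1"] deg finite_UNIV_card_ge_0[OF fin] by auto
  moreover have "poly p x = 0"
    using fin by (auto simp: p_def poly_prod)
  ultimately show False by simp
qed

lemma module_mult: "module ((*) :: 'a::comm_ring_1 \<Rightarrow> 'a \<Rightarrow> 'a)"
  by unfold_locales (simp_all add: algebra_simps)

lemma ideal_generated_finite:
  fixes B :: "'a::comm_ring_1 set"
  assumes "finite B"
  shows "f \<in> ideal_generated B \<longleftrightarrow> (\<exists>h. f = (\<Sum>g\<in>B. h g * g))"
  unfolding ideal_generated_def using module.span_finite[OF module_mult assms] by auto

text \<open>The degree-\<open>m\<close> part of \<open>\<Sum>g\<in>B. h g * g\<close> at a point \<open>z\<close>
  where every generator of degree below \<open>m\<close> vanishes. Generators of degree above \<open>m\<close> contribute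
  nothing, those of degree \<open>m\<close> only with the constant term \<open>h g 0\<close> of their coefficient.
  What matters is that these weights do not depend on \<open>z\<close>. Instead of
  splitting \<open>h g\<close> into homogeneous parts, the proof compares the coefficients of \<open>c\<^sup>m\<close>
  in the values at \<open>c *s z\<close>, as polynomials in \<open>c\<close>.\<close>

lemma degree_component_of_combination:
  fixes B :: "('n::finite, 'k::field) mpoly set" and z :: "'k ^ 'n"
  assumes inf: "infinite (UNIV :: 'k set)"
    and fin: "finite B"
    and deg: "\<And>g. g \<in> B \<Longrightarrow> homogeneous (d g) g"
    and low: "\<And>g. g \<in> B \<Longrightarrow> d g < m \<Longrightarrow> mpoly_eval g (($) z) = 0"
    and f: "homogeneous m f" "f = (\<Sum>g\<in>B. h g * g)"
  shows "mpoly_eval f (($) z) =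
    (\<Sum>g\<in>B. (if d g = m then mpoly_eval (h g) (($) 0) else 0) * mpoly_eval g (($) z))"
proof -
  obtain P where P: "\<And>g c. poly (P g) c = mpoly_eval (h g) (($) (c *s z))"
  proof -
    have "\<exists>P. \<forall>c. poly P c = mpoly_eval (h g) (($) (c *s z))" for g
      using mpoly_eval_along_line(1)[of "h g" 0 z] by simp
    then show thesis using that by metis
  qed
  \<comment> \<open>The values at \<open>c *s z\<close> agree for all \<open>c\<close>; \<open>R\<close> is their
      difference divided by \<open>c ^ m\<close>, and its value at \<open>0\<close> is the claim.\<close>
  define R where "R = [:mpoly_eval f (($) z):] -
    (\<Sum>g\<in>B. if d g < m then 0 else P g * monom (mpoly_eval g (($) z)) (d g - m))"
  have "poly R c = 0" if "c \<noteq> 0" for c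
  proof -
    have "c ^ m * mpoly_eval f (($) z) = mpoly_eval f (($) (c *s z))"
      by (simp add: homogeneous_scale[OF f(1)])
    also have "\<dots> = (\<Sum>g\<in>B. poly (P g) c * (c ^ d g * mpoly_eval g (($) z)))"
      by (subst f(2)) (simp add: mpoly_eval_sum mpoly_eval_mult P homogeneous_scale[OF deg])
    also have "\<dots> = c ^ m * (\<Sum>g\<in>B. poly (if d g < m then 0
        else P g * monom (mpoly_eval g (($) z)) (d g - m)) c)"
      unfolding sum_distrib_left
      by (rule sum.cong) (auto simp: low poly_monom power_add[symmetric])
    finally show ?thesis
      using that by (simp add: R_def poly_sum)
  qed
  then have "- {0} \<subseteq> {c. poly R c = 0}" by auto
  then have "infinite {c. poly R c = 0}"
    using inf finite_subset by (metis Compl_eq_Diff_UNIV infinite_remove)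
  then have "R = 0" using poly_roots_finite by blast
  then have "poly R 0 = 0" by simp
  then have "mpoly_eval f (($) z) = (\<Sum>g\<in>B. poly (if d g < m then 0
      else P g * monom (mpoly_eval g (($) z)) (d g - m)) 0)"
    by (simp add: R_def poly_sum)
  also have "\<dots> = (\<Sum>g\<in>B. (if d g = m then mpoly_eval (h g) (($) 0) else 0) *
      mpoly_eval g (($) z))"
    by (rule sum.cong) (auto simp: P poly_monom power_0_left)
  finally show ?thesis .
qed

text \<open>By \<open>degree_component_of_combination\<close>, the values of a form of
  degree \<open>m\<close> of the ideal at the points \<open>z j\<close> make up a vector that lies in the
  span of the value vectors of the generators. The forms \<open>f i\<close> are dual to the points up to
  scaling, so their value vectors span the whole space, whose dimension is the number of
  points.\<close>

lemma card_generators_ge: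
  fixes B :: "('n::finite, 'k::field) mpoly set" and z :: "'r::finite \<Rightarrow> 'k ^ 'n"
  assumes inf: "infinite (UNIV :: 'k set)"
    and fin: "finite B" and forms: "\<And>g. g \<in> B \<Longrightarrow> form g"
    and low: "\<And>d g j. g \<in> B \<Longrightarrow> homogeneous d g \<Longrightarrow> d < m \<Longrightarrow> mpoly_eval g (($) (z j)) = 0"
    and f: "\<And>i. homogeneous m (f i)" "\<And>i. f i \<in> ideal_generated B"
    and dual: "\<And>i j. mpoly_eval (f i) (($) (z j)) = 0 \<longleftrightarrow> i \<noteq> j"
  shows "CARD('r) \<le> card B"
proof -
  obtain d where d: "\<And>g. g \<in> B \<Longrightarrow> homogeneous (d g) g"
    using forms unfolding form_iff_homogeneous by metis
  define \<Phi> :: "('n, 'k) mpoly \<Rightarrow> 'k ^ 'r" where "\<Phi> g = (\<chi> j. mpoly_eval g (($) (z j)))" for g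
  have "\<Phi> (f i) \<in> vec.span (\<Phi> ` B)" for i
  proof -
    obtain h where h: "f i = (\<Sum>g\<in>B. h g * g)"
      using f(2) ideal_generated_finite[OF fin] by blast
    define c where "c g = (if d g = m then mpoly_eval (h g) (($) (0 :: 'k ^ 'n)) else 0)" for g
    have "mpoly_eval (f i) (($) (z j)) = (\<Sum>g\<in>B. c g * mpoly_eval g (($) (z j)))" for j
      unfolding c_def using degree_component_of_combination[OF inf fin d low f(1) h] d by auto
    then have "\<Phi> (f i) = (\<Sum>g\<in>B. c g *s \<Phi> g)"
      by (simp add: \<Phi>_def vec_eq_iff)
    also have "\<dots> \<in> vec.span (\<Phi> ` B)"
      by (intro vec.span_sum vec.span_scale vec.span_base imageI)
    finally show ?thesis .
  qed
  moreover have "axis i 1 = inverse (mpoly_eval (f i) (($) (z i))) *s \<Phi> (f i)" for i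
    using dual by (auto simp: \<Phi>_def vec_eq_iff axis_def)
  ultimately have "axis i 1 \<in> vec.span (\<Phi> ` B)" for i
    by (simp add: vec.span_scale)
  then have "vec.span (cart_basis :: ('k ^ 'r) set) \<subseteq> vec.span (\<Phi> ` B)"
    by (intro vec.span_minimal) (auto simp: cart_basis_def)
  then have "vec.dim (UNIV :: ('k ^ 'r) set) \<le> card (\<Phi> ` B)"
    by (intro vec.dim_le_card) (auto simp: fin)
  also have "\<dots> \<le> card B" by (rule card_image_le[OF fin])
  finally show ?thesis by (simp add: vec.dim_UNIV card_cart_basis)
qed

section \<open>Binary forms on a line\<close>

text \<open>The determinant of two coordinate pairs on a line; for nonzero pairs it vanishes exactly if
  they are proportional, that is, if they describe the same point.\<close>

definition bracket :: "'k::field \<times> 'k \<Rightarrow> 'k \<times> 'k \<Rightarrow> 'k" where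
  "bracket s t = fst s * snd t - snd s * fst t"

definition line_pt :: "'k::field ^ 'n \<Rightarrow> 'k ^ 'n \<Rightarrow> 'k \<times> 'k \<Rightarrow> 'k ^ 'n" where
  "line_pt a b s = fst s *s a + snd s *s b"

lemma bracket_self [simp]: "bracket s s = 0"
  by (simp add: bracket_def)

lemma bracket_swap_eq_0: "bracket s t = 0 \<longleftrightarrow> bracket t s = 0"
  by (auto simp: bracket_def algebra_simps)

lemma proportional_if_bracket_eq_0:
  assumes "bracket s t = 0" "t \<noteq> (0, 0)"
  obtains c where "s = (c * fst t, c * snd t)"
proof (cases "fst t = 0")
  case True
  then have "snd t \<noteq> 0" using assms(2) by (cases t) auto
  then show ?thesis using that[of "snd s / snd t"] True assms(1)
    by (cases s) (auto simp: bracket_def)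
next
  case False
  then show ?thesis using that[of "fst s / fst t"] assms(1)
    by (cases s) (auto simp: bracket_def field_simps)
qed

text \<open>Each point of \<open>T\<close> excludes at most one of the infinitely many points \<open>(1, x)\<close>.\<close>

lemma exists_bracket_nonzero:
  fixes T :: "('k::field \<times> 'k) set"
  assumes "infinite (UNIV :: 'k set)" "finite T" "(0, 0) \<notin> T"
  shows "\<exists>w. \<forall>t\<in>T. bracket w t \<noteq> 0"
proof -
  obtain x where x: "x \<notin> (\<lambda>t. snd t / fst t) ` T"
    using ex_new_if_finite[OF assms(1)] assms(2) by blast
  have "bracket (1, x) t \<noteq> 0" if "t \<in> T" for t
  proof
    assume "bracket (1, x) t = 0"
    then have eq: "snd t = x * fst t" by (simp add: bracket_def)
    with that assms(3) have "fst t \<noteq> 0" by (cases t) auto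
    with eq have "x = snd t / fst t" by simp
    with x that show False by blast
  qed
  then show ?thesis by blast
qed

text \<open>To count zeros of an ordinary polynomial, the points of the line are reached from
  \<open>t \<noteq> 0\<close> as \<open>t + c w\<close>, where \<open>w\<close> avoids \<open>t\<close> and the known zeros: then every known zero is
  reached, up to scaling, at exactly one \<open>c\<close>, and different zeros at different \<open>c\<close>.\<close>

lemma binary_form_eq_0:
  fixes a b :: "'k::field ^ 'n::finite" and T :: "('k \<times> 'k) set"
  assumes inf: "infinite (UNIV :: 'k set)"
    and f: "homogeneous d f"
    and T: "finite T" "d < card T" "(0, 0) \<notin> T"
      "pairwise (\<lambda>t t'. bracket t t' \<noteq> 0) T"
    and zero: "\<And>t. t \<in> T \<Longrightarrow> mpoly_eval f (($) (line_pt a b t)) = 0"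
  shows "mpoly_eval f (($) (line_pt a b t)) = 0"
proof (cases "t = (0, 0)")
  case True
  obtain t0 where "t0 \<in> T" using T(2) by (cases "T = {}") auto
  then show ?thesis
    using homogeneous_scale[OF f, of 0 "line_pt a b t0"] zero True by (simp add: line_pt_def)
next
  case False
  obtain w where w: "\<And>t'. t' \<in> insert t T \<Longrightarrow> bracket w t' \<noteq> 0"
    using exists_bracket_nonzero[OF inf, of "insert t T"] T False by auto
  define u where "u c = (fst t + c * fst w, snd t + c * snd w)" for c
  have u: "line_pt a b (u c) = line_pt a b t + c *s line_pt a b w" for c
    by (simp add: u_def line_pt_def vec_eq_iff algebra_simps)
  obtain P where P: "degree P \<le> d" "\<And>c. poly P c = mpoly_eval f (($) (line_pt a b (u c)))"
    using mpoly_eval_along_line(2)[OF f, of "line_pt a b t" "line_pt a b w"] unfolding u by auto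
  define r where "r t' = - bracket t t' / bracket w t'" for t'
  have on_ray: "bracket (u (r t')) t' = 0" if "t' \<in> T" for t'
  proof -
    have "bracket (u (r t')) t' = bracket t t' + r t' * bracket w t'"
      by (simp add: u_def bracket_def algebra_simps)
    then show ?thesis using w that by (simp add: r_def)
  qed
  have root: "poly P (r t') = 0" if t': "t' \<in> T" for t'
  proof -
    have "t' \<noteq> (0, 0)" using t' T(3) by metis
    then obtain c where "u (r t') = (c * fst t', c * snd t')"
      using proportional_if_bracket_eq_0 on_ray[OF t'] by metis
    then have "line_pt a b (u (r t')) = c *s line_pt a b t'"
      by (simp add: line_pt_def vec_eq_iff algebra_simps)
    then show ?thesis by (simp add: P(2) homogeneous_scale[OF f] zero t')
  qed
  have "inj_on r T"
  proof (rule inj_onI, rule ccontr)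
    \<comment> \<open>A vector proportional to both \<open>x\<close>
        and \<open>y\<close> is zero, but \<open>t + c w\<close> never is, as \<open>t\<close> and \<open>w\<close> are independent.\<close>
    fix x y assume xy: "x \<in> T" "y \<in> T" "r x = r y" "x \<noteq> y"
    have "x \<noteq> (0, 0)" using xy T(3) by metis
    then obtain c where c: "u (r x) = (c * fst x, c * snd x)"
      using proportional_if_bracket_eq_0 on_ray[OF xy(1)] by metis
    have "c * bracket x y = bracket (u (r x)) y"
      unfolding c by (simp add: bracket_def algebra_simps)
    also have "\<dots> = 0" using on_ray[OF xy(2)] xy(3) by simp
    finally have "c = 0" using T(4) xy by (auto simp: pairwise_def)
    with c have "u (r x) = (0, 0)" by simp
    then have "bracket w t = 0" by (simp add: u_def bracket_def) algebra
    then show False using w by simp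
  qed
  have "P = 0"
  proof (rule ccontr)
    assume "P \<noteq> 0"
    have "card T = card (r ` T)" using \<open>inj_on r T\<close> by (simp add: card_image)
    also have "\<dots> \<le> card {c. poly P c = 0}"
      by (rule card_mono[OF poly_roots_finite[OF \<open>P \<noteq> 0\<close>]]) (use root in auto)
    also have "\<dots> \<le> degree P" using card_poly_roots_bound \<open>P \<noteq> 0\<close> by blast
    finally show False using P(1) T(2) by simp
  qed
  then show ?thesis using P(2)[of 0] by (simp add: u_def)
qed

section \<open>Grids on a product of two lines\<close>

lemma vanishing_ideal_vanishes:
  assumes "f \<in> vanishing_ideal Z" "P \<in> Z" "p \<in> P"
  shows "mpoly_eval f (($) p) = 0"
proof -
  have "vanishing_ideal Z \<subseteq> {f. mpoly_eval f (($) p) = 0}"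
    unfolding vanishing_ideal_def ideal_generated_def
  proof (rule module.span_minimal[OF module_mult])
    show "module.subspace (*) {f. mpoly_eval f (($) p) = 0}"
      by (auto simp: module.subspace_def[OF module_mult] mpoly_eval_add mpoly_eval_mult)
  qed (use assms in auto)
  then show ?thesis using assms(1) by blast
qed

lemma form_in_vanishing_ideal:
  assumes "form f" "\<And>P p. P \<in> Z \<Longrightarrow> p \<in> P \<Longrightarrow> mpoly_eval f (($) p) = 0"
  shows "f \<in> vanishing_ideal Z"
  unfolding vanishing_ideal_def ideal_generated_def
  by (rule module.span_base[OF module_mult]) (use assms in auto)

lemma line_pt_mult:
  "line_pt a b s * q = line_pt (a * q) (b * q) s"
  "p * line_pt a b s = line_pt (p * a) (p * b) s"
  by (simp_all add: line_pt_def vec_eq_iff algebra_simps)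

text \<open>The map \<open>(s, t) \<mapsto> line_pt a b s * line_pt a' b' t\<close> from the product of two lines is, up
  to a linear change of coordinates, the Segre embedding: every product of a linear form in
  \<open>s\<close> and a linear form in \<open>t\<close> is induced by a plane. (A linear form in two
  variables is \<open>bracket l\<close> for some \<open>l\<close>.)\<close>

definition separates_lines ::
  "'k::field ^ 'n::finite \<Rightarrow> 'k ^ 'n \<Rightarrow> 'k ^ 'n \<Rightarrow> 'k ^ 'n \<Rightarrow> bool" where
  "separates_lines a b a' b' \<longleftrightarrow> (\<forall>l l'. \<exists>h. homogeneous 1 h \<and>
     (\<forall>s t. mpoly_eval h (($) (line_pt a b s * line_pt a' b' t)) = bracket l s * bracket l' t))"

text \<open>Unions of planes cut out on the Segre quadric arbitrary products of equally many linear forms in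
  either variable. All test forms are of this kind.\<close>

lemma product_form_exists:
  assumes "separates_lines a b a' b'" "finite I"
  shows "\<exists>f. homogeneous (card I) f \<and> (\<forall>s t. mpoly_eval f (($) (line_pt a b s * line_pt a' b' t)) =
    (\<Prod>i\<in>I. bracket (l i) s * bracket (l' i) t))"
proof -
  obtain h where h: "\<And>i. homogeneous 1 (h i)"
    "\<And>i s t. mpoly_eval (h i) (($) (line_pt a b s * line_pt a' b' t)) =
      bracket (l i) s * bracket (l' i) t"
  proof -
    have "\<exists>h. homogeneous 1 h \<and>
      (\<forall>s t. mpoly_eval h (($) (line_pt a b s * line_pt a' b' t)) = bracket (l i) s * bracket (l' i) t)" for i
      using assms(1) unfolding separates_lines_def by blast
    then show thesis using that by metis
  qed
  have "homogeneous (card I) (\<Prod>i\<in>I. h i)"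
    by (rule homogeneous_prod) (use h assms in auto)
  then show ?thesis by (intro exI[of _ "\<Prod>i\<in>I. h i"]) (simp add: mpoly_eval_prod h)
qed

text \<open>Zeros are counted first along the lines of one ruling through the points of \<open>S\<close> and then along all
  lines of the other ruling. So for an \<open>m \<times> m\<close> grid, generators of
  degree less than \<open>m\<close> vanish on the whole quadric.\<close>

lemma grid_form_eq_0:
  fixes a b a' b' :: "'k::field ^ 'n::finite"
  assumes inf: "infinite (UNIV :: 'k set)"
    and S: "finite S" "d < card S" "(0, 0) \<notin> S" "pairwise (\<lambda>s s'. bracket s s' \<noteq> 0) S"
    and T: "finite T" "d < card T" "(0, 0) \<notin> T" "pairwise (\<lambda>t t'. bracket t t' \<noteq> 0) T"
    and f: "homogeneous d f"
      "\<And>s t. s \<in> S \<Longrightarrow> t \<in> T \<Longrightarrow> mpoly_eval f (($) (line_pt a b s * line_pt a' b' t)) = 0"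
  shows "mpoly_eval f (($) (line_pt a b s * line_pt a' b' t)) = 0"
proof -
  have "mpoly_eval f (($) (line_pt a b s * line_pt a' b' t)) = 0" if "s \<in> S" for s
    unfolding line_pt_mult(2) using binary_form_eq_0[OF inf f(1) T] f(2)[OF that]
    unfolding line_pt_mult(2) by blast
  then show ?thesis
    unfolding line_pt_mult(1) using binary_form_eq_0[OF inf f(1) S] by blast
qed

text \<open>In bidegree \<open>(m, m)\<close> the ideal of the grid consists of the multiples of
  \<open>\<Prod>i\<in>S. bracket i s\<close> and of \<open>\<Prod>i\<in>T. bracket i t\<close>, a space of dimension
  \<open>2 m + 1\<close>. Only four independent elements are wanted. Three of them are the first
  product times a form of degree \<open>m\<close> in \<open>t\<close>, and they are tested at points
  \<open>(p, \<rho>)\<close> with \<open>p\<close> outside \<open>S\<close>; the fourth is the second product times the form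
  \<open>bracket p s ^ m\<close>, which vanishes at these points, and its test point lies over \<open>S\<close>, where
  the first product vanishes.\<close>

lemma dual_grid_forms:
  fixes a b a' b' :: "'k::field ^ 'n::finite" and S T :: "('k \<times> 'k) set"
  assumes inf: "infinite (UNIV :: 'k set)"
    and sep: "separates_lines a b a' b'"
    and S: "finite S" "card S = m" "(0, 0) \<notin> S"
    and T: "finite T" "card T = m" "(0, 0) \<notin> T"
    and m: "m \<ge> 2"
  obtains f :: "4 \<Rightarrow> ('n, 'k) mpoly" and u v :: "4 \<Rightarrow> 'k \<times> 'k"
  where "\<And>i. homogeneous m (f i)"
    "\<And>i s t. s \<in> S \<Longrightarrow> t \<in> T \<Longrightarrow> mpoly_eval (f i) (($) (line_pt a b s * line_pt a' b' t)) = 0"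
    "\<And>i j. mpoly_eval (f i) (($) (line_pt a b (u j) * line_pt a' b' (v j))) = 0 \<longleftrightarrow> i \<noteq> j"
proof -
  let ?z = "\<lambda>s t. ($) (line_pt a b s * line_pt a' b' t)"
  obtain x y where xy: "x \<in> S" "y \<in> S" "x \<noteq> y"
    using card_le_Suc0_iff_eq[OF S(1)] S(2) m by force
  obtain t0 where t0: "t0 \<in> T" using T m by (cases "T = {}") auto
  obtain p q where p: "\<And>s. s \<in> S \<Longrightarrow> bracket p s \<noteq> 0" and q: "\<And>t. t \<in> T \<Longrightarrow> bracket q t \<noteq> 0"
    using exists_bracket_nonzero[OF inf] S T by meson
  \<comment> \<open>The form in \<open>t\<close> is
      \<open>bracket \<tau> t * bracket \<sigma> t ^ (m - 1)\<close>. It has zeros at both \<open>\<tau>\<close> and \<open>\<sigma>\<close>,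
      because \<open>m \<ge> 2\<close>.\<close>
  have "\<exists>f. homogeneous m f \<and> (\<forall>s t. mpoly_eval f (?z s t) =
      (\<Prod>i\<in>S. bracket i s * bracket (if i = x then \<tau> else \<sigma>) t))" for \<tau> \<sigma>
    using product_form_exists[OF sep S(1), of "\<lambda>i. i"] S(2) by simp
  then obtain F where F: "\<And>\<tau> \<sigma>. homogeneous m (F \<tau> \<sigma>)"
    "\<And>\<tau> \<sigma> s t. mpoly_eval (F \<tau> \<sigma>) (?z s t) =
      (\<Prod>i\<in>S. bracket i s * bracket (if i = x then \<tau> else \<sigma>) t)" by metis
  obtain G where G: "homogeneous m G" "\<And>s t. mpoly_eval G (?z s t) = (\<Prod>i\<in>T. bracket p s * bracket i t)"
    using product_form_exists[OF sep T(1), of "\<lambda>_. p" "\<lambda>i. i"] T(2) by auto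
  have F_grid: "mpoly_eval (F \<tau> \<sigma>) (?z s t) = 0" if "s \<in> S" for \<tau> \<sigma> s t
    unfolding F(2) using that S(1) by (auto intro!: bexI[of _ s])
  have G_grid: "mpoly_eval G (?z s t) = 0" if "t \<in> T" for s t
    unfolding G(2) using that T(1) by (auto intro!: bexI[of _ t])
  have F_zero: "mpoly_eval (F \<tau> \<sigma>) (?z s \<tau>) = 0" "mpoly_eval (F \<tau> \<sigma>) (?z s \<sigma>) = 0" for \<tau> \<sigma> s
  proof -
    show "mpoly_eval (F \<tau> \<sigma>) (?z s \<tau>) = 0"
      unfolding F(2) by (rule prod_zero[OF S(1) bexI[OF _ xy(1)]]) simp
    show "mpoly_eval (F \<tau> \<sigma>) (?z s \<sigma>) = 0"
      unfolding F(2) by (rule prod_zero[OF S(1) bexI[OF _ xy(2)]]) (use xy(3) in simp)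
  qed
  have F_nz: "mpoly_eval (F \<tau> \<sigma>) (?z p \<rho>) \<noteq> 0" if "bracket \<tau> \<rho> \<noteq> 0" "bracket \<sigma> \<rho> \<noteq> 0" for \<tau> \<sigma> \<rho>
    unfolding F(2) using S(1) that p by (auto simp: bracket_swap_eq_0[of _ p])
  have G_zero: "mpoly_eval G (?z p t) = 0" for t
    unfolding G(2) by (rule prod_zero[OF T(1) bexI[OF _ t0]]) simp
  have G_nz: "mpoly_eval G (?z x q) \<noteq> 0"
    unfolding G(2) using T(1) p q xy by (auto simp: bracket_swap_eq_0[of _ q])
  \<comment> \<open>Three different points of the line exist over every field.\<close>
  define \<alpha> \<beta> \<gamma> :: "'k \<times> 'k" where "\<alpha> = (1, 0)" and "\<beta> = (0, 1)" and "\<gamma> = (1, 1)"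
  have br: "bracket \<alpha> \<beta> \<noteq> 0" "bracket \<beta> \<alpha> \<noteq> 0" "bracket \<alpha> \<gamma> \<noteq> 0" "bracket \<gamma> \<alpha> \<noteq> 0"
    "bracket \<beta> \<gamma> \<noteq> 0" "bracket \<gamma> \<beta> \<noteq> 0"
    by (simp_all add: \<alpha>_def \<beta>_def \<gamma>_def bracket_def)
  define f :: "4 \<Rightarrow> ('n, 'k) mpoly" where
    "f i = (if i = 1 then F \<beta> \<gamma> else if i = 2 then F \<alpha> \<gamma> else if i = 3 then F \<alpha> \<beta> else G)" for i
  define u v :: "4 \<Rightarrow> 'k \<times> 'k" where
    "u i = (if i = 4 then x else p)" and
    "v i = (if i = 1 then \<alpha> else if i = 2 then \<beta> else if i = 3 then \<gamma> else q)" for i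
  show thesis
  proof (rule that[of f u v])
    show "homogeneous m (f i)" for i by (simp add: f_def F G)
    show "mpoly_eval (f i) (?z s t) = 0" if "s \<in> S" "t \<in> T" for i s t
      using that by (simp add: f_def F_grid G_grid)
    have "\<forall>i j. mpoly_eval (f i) (?z (u j) (v j)) = 0 \<longleftrightarrow> i \<noteq> j"
      unfolding forall_4 by (simp add: f_def u_def v_def F_zero F_nz br G_zero G_nz F_grid xy)
    then show "mpoly_eval (f i) (?z (u j) (v j)) = 0 \<longleftrightarrow> i \<noteq> j" for i j by blast
  qed
qed

lemma mem_ppoint: "p \<in> ppoint v \<longleftrightarrow> (\<exists>c. c \<noteq> 0 \<and> p = c *s v)"
  by (auto simp: ppoint_def)

lemma self_in_ppoint: "v \<in> ppoint v"
  unfolding mem_ppoint by (intro exI[of _ 1]) simp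

text \<open>The four dual forms need at least four generators, whereas a complete intersection in
  three-dimensional space has three.\<close>

lemma grid_not_complete_intersection:
  fixes a b a' b' :: "'k::field ^ 4" and S T :: "('k \<times> 'k) set"
  assumes inf: "infinite (UNIV :: 'k set)"
    and sep: "separates_lines a b a' b'"
    and S: "finite S" "(0, 0) \<notin> S" "pairwise (\<lambda>s s'. bracket s s' \<noteq> 0) S" "2 \<le> card S"
    and T: "finite T" "(0, 0) \<notin> T" "pairwise (\<lambda>t t'. bracket t t' \<noteq> 0) T" "card T = card S"
    and nz: "\<And>s t. s \<in> S \<Longrightarrow> t \<in> T \<Longrightarrow> line_pt a b s * line_pt a' b' t \<noteq> 0"
  shows "\<not> complete_intersection
    (((\<lambda>s. ppoint (line_pt a b s)) ` S) \<star> ((\<lambda>t. ppoint (line_pt a' b' t)) ` T))"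
proof
  let ?Z = "((\<lambda>s. ppoint (line_pt a b s)) ` S) \<star> ((\<lambda>t. ppoint (line_pt a' b' t)) ` T)"
  let ?z = "\<lambda>s t. line_pt a b s * line_pt a' b' t"
  assume "complete_intersection ?Z"
  then obtain g :: "nat \<Rightarrow> (4, 'k) mpoly" where
    g: "\<And>i. i < 3 \<Longrightarrow> form (g i)" "vanishing_ideal ?Z = ideal_generated (g ` {..<3})"
    unfolding complete_intersection_def by auto
  define B where "B = g ` {..<3}"
  have B: "finite B" "\<And>h. h \<in> B \<Longrightarrow> form h" "vanishing_ideal ?Z = ideal_generated B"
    using g by (auto simp: B_def)
  have Z_mem: "ppoint (?z s t) \<in> ?Z" if "s \<in> S" "t \<in> T" for s t
  proof -
    have "line_pt a b s \<in> ppoint (line_pt a b s)" "line_pt a' b' t \<in> ppoint (line_pt a' b' t)"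
      by (rule self_in_ppoint)+
    then show ?thesis using that nz[OF that] unfolding hadamard_def by blast
  qed
  have Z_cases: "\<exists>s\<in>S. \<exists>t\<in>T. \<exists>c. p = c *s ?z s t" if P: "P \<in> ?Z" "p \<in> P" for P p
  proof -
    obtain s t c c' where st: "s \<in> S" "t \<in> T" "P = ppoint ((c *s line_pt a b s) * (c' *s line_pt a' b' t))"
      proof -
      obtain p q where pq: "P = ppoint (p * q)" "p \<in> \<Union>((\<lambda>s. ppoint (line_pt a b s)) ` S)"
        "q \<in> \<Union>((\<lambda>t. ppoint (line_pt a' b' t)) ` T)"
        using P(1) unfolding hadamard_def by blast
      obtain s c where "s \<in> S" "p = c *s line_pt a b s" using pq(2) by (auto simp: mem_ppoint)
      moreover obtain t c' where "t \<in> T" "q = c' *s line_pt a' b' t" using pq(3) by (auto simp: mem_ppoint)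
      ultimately show thesis using that pq(1) by blast
    qed
    obtain k where "p = k *s ((c *s line_pt a b s) * (c' *s line_pt a' b' t))"
      using P(2) st(3) by (auto simp: mem_ppoint)
    then have "p = (k * c * c') *s ?z s t" by (simp add: vec_eq_iff)
    then show ?thesis using st by blast
  qed
  have low: "mpoly_eval h (($) (?z s t)) = 0" if "h \<in> B" "homogeneous d h" "d < card S" for h d s t
  proof (rule grid_form_eq_0[OF inf _ _ _ _ _ _ _ _ that(2)])
    fix s t assume st: "s \<in> S" "t \<in> T"
    have "h \<in> vanishing_ideal ?Z"
      unfolding B(3) ideal_generated_def
      by (rule module.span_base[OF module_mult that(1)])
    then show "mpoly_eval h (($) (?z s t)) = 0"
      using vanishing_ideal_vanishes[OF _ Z_mem[OF st] self_in_ppoint] by blast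
  qed (use S T that in auto)
  obtain f u v where f: "\<And>i::4. homogeneous (card S) (f i)"
    "\<And>i s t. s \<in> S \<Longrightarrow> t \<in> T \<Longrightarrow> mpoly_eval (f i) (($) (?z s t)) = 0"
    "\<And>i j. mpoly_eval (f i) (($) (?z (u j) (v j))) = 0 \<longleftrightarrow> i \<noteq> j"
    using dual_grid_forms[OF inf sep S(1) refl S(2) T(1) T(4) T(2) S(4)] by metis
  have "f i \<in> ideal_generated B" for i
    unfolding B(3)[symmetric]
  proof (rule form_in_vanishing_ideal)
    show "form (f i)" using f(1) form_iff_homogeneous by blast
    show "mpoly_eval (f i) (($) p) = 0" if "P \<in> ?Z" "p \<in> P" for P p
      using Z_cases[OF that] f(2) by (auto simp: homogeneous_scale[OF f(1)])
  qed
  then have "CARD(4) \<le> card B"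
    by (intro card_generators_ge[OF inf B(1,2), where m = "card S" and f = f and z = "\<lambda>j. ?z (u j) (v j)"])
      (use f low in auto)
  moreover have "card B \<le> 3" unfolding B_def using card_image_le[of "{..<3::nat}" g] by simp
  ultimately show False by simp
qed

section \<open>Generic pairs of lines\<close>

text \<open>A line spanned by \<open>a\<close> and \<open>b\<close> meets the four coordinate planes in points whose parameters have
  the brackets \<open>a $ i * b $ j - a $ j * b $ i\<close>, the Pluecker coordinates. The form below
  vanishes if the cross ratios of these quadruples of points agree on the two
  lines. Up to sign it is the determinant of the four vectors \<open>a * a'\<close>, \<open>a * b'\<close>,
  \<open>b * a'\<close>, \<open>b * b'\<close>, written as a form of bidegree \<open>(2, 2)\<close> in the Pluecker
  coordinates.\<close>

definition cross_ratio_form :: "'k::field ^ (4 \<times> 4) \<Rightarrow> 'k ^ (4 \<times> 4) \<Rightarrow> 'k" where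
  "cross_ratio_form P Q =
     P $ (1, 2) * P $ (3, 4) * Q $ (1, 3) * Q $ (2, 4) - P $ (1, 3) * P $ (2, 4) * Q $ (1, 2) * Q $ (3, 4)"

lemma wedge_nth: "wedge a b $ (i, j) = a $ i * b $ j - a $ j * b $ i"
  by (simp add: wedge_def)

text \<open>With \<open>u i = (a $ i, b $ i)\<close> and \<open>u' i\<close> likewise, the hypotheses say that
  \<open>\<Sum>i. x i \<cdot> u i \<otimes> u' i = 0\<close>. Contracting this with \<open>u j\<close> and \<open>u' k\<close> removes the
  terms \<open>i = j\<close> and \<open>i = k\<close>. So the choices \<open>(j, k) = (1, 2), (2, 1)\<close> give two linear equations
  for \<open>x 3\<close> and \<open>x 4\<close>, and \<open>(3, 4), (4, 3)\<close> give two for \<open>x 1\<close> and \<open>x 2\<close>. Both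
  systems have the same determinant, which is \<^const>\<open>cross_ratio_form\<close> by
  the Pluecker relations.\<close>

lemma products_independent:
  fixes a b a' b' x :: "'k::field ^ 4"
  assumes D: "cross_ratio_form (wedge a b) (wedge a' b') \<noteq> 0"
    and x: "(\<Sum>i\<in>UNIV. x $ i * (a * a') $ i) = 0" "(\<Sum>i\<in>UNIV. x $ i * (a * b') $ i) = 0"
      "(\<Sum>i\<in>UNIV. x $ i * (b * a') $ i) = 0" "(\<Sum>i\<in>UNIV. x $ i * (b * b') $ i) = 0"
  shows "x = 0"
proof -
  define u u' where "u i = (a $ i, b $ i)" and "u' i = (a' $ i, b' $ i)" for i
  let ?D = "bracket (u 1) (u 3) * bracket (u 2) (u 4) * bracket (u' 1) (u' 4) * bracket (u' 2) (u' 3)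
    - bracket (u 1) (u 4) * bracket (u 2) (u 3) * bracket (u' 1) (u' 3) * bracket (u' 2) (u' 4)"
  have D': "?D \<noteq> 0"
    using D unfolding cross_ratio_form_def wedge_nth bracket_def u_def u'_def
    by (simp add: algebra_simps)
  have contract: "(\<Sum>i\<in>UNIV. x $ i * bracket (u j) (u i) * bracket (u' k) (u' i)) = 0" for j k
  proof -
    have "(\<Sum>i\<in>UNIV. x $ i * bracket (u j) (u i) * bracket (u' k) (u' i)) =
        a $ j * a' $ k * (\<Sum>i\<in>UNIV. x $ i * (b * b') $ i)
      - a $ j * b' $ k * (\<Sum>i\<in>UNIV. x $ i * (b * a') $ i)
      - b $ j * a' $ k * (\<Sum>i\<in>UNIV. x $ i * (a * b') $ i)
      + b $ j * b' $ k * (\<Sum>i\<in>UNIV. x $ i * (a * a') $ i)"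
      unfolding sum_distrib_left sum.distrib[symmetric] sum_subtractf[symmetric]
      by (rule sum.cong) (auto simp: bracket_def u_def u'_def algebra_simps)
    then show ?thesis unfolding x by simp
  qed
  have elim: "y * (\<alpha> * \<delta> - \<beta> * \<gamma>) = 0" "z * (\<alpha> * \<delta> - \<beta> * \<gamma>) = 0"
    if "y * \<alpha> + z * \<beta> = 0" "y * \<gamma> + z * \<delta> = 0" for y z \<alpha> \<beta> \<gamma> \<delta> :: 'k
  proof -
    have "y * (\<alpha> * \<delta> - \<beta> * \<gamma>) = \<delta> * (y * \<alpha> + z * \<beta>) - \<beta> * (y * \<gamma> + z * \<delta>)"
      "z * (\<alpha> * \<delta> - \<beta> * \<gamma>) = \<alpha> * (y * \<gamma> + z * \<delta>) - \<gamma> * (y * \<alpha> + z * \<beta>)"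
      by (simp_all only: algebra_simps)
    then show "y * (\<alpha> * \<delta> - \<beta> * \<gamma>) = 0" "z * (\<alpha> * \<delta> - \<beta> * \<gamma>) = 0"
      using that by simp_all
  qed
  have swap: "bracket s t = - bracket t s" for s t :: "'k \<times> 'k" by (simp add: bracket_def)
  have c12: "x $ 3 * (bracket (u 1) (u 3) * bracket (u' 2) (u' 3)) +
      x $ 4 * (bracket (u 1) (u 4) * bracket (u' 2) (u' 4)) = 0"
    using contract[of 1 2] by (simp add: sum_4 mult.assoc)
  have c21: "x $ 3 * (bracket (u 2) (u 3) * bracket (u' 1) (u' 3)) +
      x $ 4 * (bracket (u 2) (u 4) * bracket (u' 1) (u' 4)) = 0"
    using contract[of 2 1] by (simp add: sum_4 mult.assoc)
  have c34: "x $ 1 * (bracket (u 1) (u 3) * bracket (u' 1) (u' 4)) +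
      x $ 2 * (bracket (u 2) (u 3) * bracket (u' 2) (u' 4)) = 0"
    using contract[of 3 4]
    by (simp add: sum_4 mult.assoc swap[of "u 3" "u 1"] swap[of "u 3" "u 2"]
        swap[of "u' 4" "u' 1"] swap[of "u' 4" "u' 2"])
  have c43: "x $ 1 * (bracket (u 1) (u 4) * bracket (u' 1) (u' 3)) +
      x $ 2 * (bracket (u 2) (u 4) * bracket (u' 2) (u' 3)) = 0"
    using contract[of 4 3]
    by (simp add: sum_4 mult.assoc swap[of "u 4" "u 1"] swap[of "u 4" "u 2"]
        swap[of "u' 3" "u' 1"] swap[of "u' 3" "u' 2"])
  have "x $ 3 * ?D = 0" "x $ 4 * ?D = 0" "x $ 1 * ?D = 0" "x $ 2 * ?D = 0"
    using elim[OF c12 c21] elim[OF c34 c43] by (simp_all add: ac_simps)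
  then show ?thesis using D' by (simp add: vec_eq_iff forall_4)
qed

text \<open>A linear form on the space is determined by its values at the four products of spanning
  vectors, and by their independence these values can be prescribed.\<close>

lemma separates_lines_if_generic:
  fixes a b a' b' :: "'k::field ^ 4"
  assumes D: "cross_ratio_form (wedge a b) (wedge a' b') \<noteq> 0"
  shows "separates_lines a b a' b'"
  unfolding separates_lines_def
proof (intro allI)
  fix l l' :: "'k \<times> 'k"
  \<comment> \<open>\<open>\<phi>\<close> sends the coefficients of a linear form to its values at the
      four products.\<close>
  define w :: "4 \<Rightarrow> 'k ^ 4" where
    "w k = (if k = 1 then a * a' else if k = 2 then a * b' else if k = 3 then b * a' else b * b')" for k
  define \<phi> :: "'k ^ 4 \<Rightarrow> 'k ^ 4" where "\<phi> x = (\<chi> k. \<Sum>i\<in>UNIV. x $ i * w k $ i)" for x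
  have lin: "Vector_Spaces.linear (*s) (*s) \<phi>"
    by unfold_locales
      (auto simp: \<phi>_def vec_eq_iff algebra_simps sum.distrib sum_distrib_left)
  have "x = 0" if "\<phi> x = 0" for x
    by (rule products_independent[OF D])
      (use that in \<open>auto simp: \<phi>_def vec_eq_iff forall_4 w_def\<close>)
  then have "inj \<phi>" using vec.linear_inj_iff_eq_0[OF lin] by blast
  then have "surj \<phi>" using vec.linear_injective_imp_surjective[OF lin] by blast
  \<comment> \<open>These are the coefficients of \<open>bracket l s * bracket l' t\<close>.\<close>
  define r :: "'k ^ 4" where "r = (\<chi> k. if k = 1 then snd l * snd l' else if k = 2 then - snd l * fst l'
      else if k = 3 then - fst l * snd l' else fst l * fst l')"
  obtain c where c: "\<phi> c = r" using \<open>surj \<phi>\<close> by (metis surjD)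
  have vals: "(\<Sum>i\<in>UNIV. c $ i * (a * a') $ i) = snd l * snd l'"
    "(\<Sum>i\<in>UNIV. c $ i * (a * b') $ i) = - snd l * fst l'"
    "(\<Sum>i\<in>UNIV. c $ i * (b * a') $ i) = - fst l * snd l'"
    "(\<Sum>i\<in>UNIV. c $ i * (b * b') $ i) = fst l * fst l'"
    using c by (simp_all add: r_def \<phi>_def vec_eq_iff forall_4 w_def)
  obtain h where h: "homogeneous 1 h" "\<And>x. mpoly_eval h x = (\<Sum>i\<in>UNIV. c $ i * x i)"
    using linear_form_exists[of "($) c"] by blast
  have "mpoly_eval h (($) (line_pt a b s * line_pt a' b' t)) = bracket l s * bracket l' t" for s t
  proof -
    have "mpoly_eval h (($) (line_pt a b s * line_pt a' b' t)) =
        fst s * fst t * (\<Sum>i\<in>UNIV. c $ i * (a * a') $ i)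
      + fst s * snd t * (\<Sum>i\<in>UNIV. c $ i * (a * b') $ i)
      + snd s * fst t * (\<Sum>i\<in>UNIV. c $ i * (b * a') $ i)
      + snd s * snd t * (\<Sum>i\<in>UNIV. c $ i * (b * b') $ i)"
      unfolding h(2) sum_distrib_left sum.distrib[symmetric]
      by (rule sum.cong) (auto simp: line_pt_def algebra_simps)
    also have "\<dots> = bracket l s * bracket l' t"
      unfolding vals by (simp add: bracket_def algebra_simps)
    finally show ?thesis .
  qed
  with h(1) show "\<exists>h. homogeneous 1 h \<and> (\<forall>s t. mpoly_eval h (($) (line_pt a b s * line_pt a' b' t)) =
      bracket l s * bracket l' t)" by blast
qed

text \<open>A zero product would lie in every plane, also in one that induces a product of linear forms
  without zeros at \<open>s\<close> and \<open>t\<close>.\<close>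

lemma separates_lines_product_nonzero:
  assumes "separates_lines a b a' b'" "s \<noteq> (0, 0)" "t \<noteq> (0, 0)"
  shows "line_pt a b s * line_pt a' b' t \<noteq> 0"
proof
  assume zero: "line_pt a b s * line_pt a' b' t = 0"
  have "\<exists>l. bracket l r \<noteq> 0" if "r \<noteq> (0, 0)" for r :: "'a \<times> 'a"
  proof (cases "fst r = 0")
    case True
    then show ?thesis using that by (cases r) (auto simp: bracket_def intro!: exI[of _ 1])
  next
    case False
    then show ?thesis by (intro exI[of _ "(0, 1)"]) (simp add: bracket_def)
  qed
  then obtain l l' where l: "bracket l s \<noteq> 0" "bracket l' t \<noteq> 0" using assms by metis
  obtain h where "homogeneous 1 h" "mpoly_eval h (($) (line_pt a b s * line_pt a' b' t)) =
      bracket l s * bracket l' t"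
    using assms(1) unfolding separates_lines_def by blast
  then show False
    using homogeneous_scale[of 1 h 0 "0 :: 'a ^ 'b"] l zero by simp
qed

section \<open>Lines and their Pluecker coordinates\<close>

definition line_through :: "'k::field ^ 'n \<Rightarrow> 'k ^ 'n \<Rightarrow> ('k, 'n) ppoint set" where
  "line_through a b = {ppoint (line_pt a b s) | s. s \<noteq> (0, 0)}"

definition spans_line :: "'k::field ^ 'n \<Rightarrow> 'k ^ 'n \<Rightarrow> bool" where
  "spans_line a b \<longleftrightarrow> (\<forall>s. line_pt a b s = 0 \<longrightarrow> s = (0, 0))"

lemma line_pt_eq_0_iff: "spans_line a b \<Longrightarrow> line_pt a b s = 0 \<longleftrightarrow> s = (0, 0)"
  unfolding spans_line_def by (auto simp only:) (simp add: line_pt_def)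

lemma spans_line_iff:
  "spans_line a b \<longleftrightarrow> a \<noteq> b \<and> vec.independent {a, b :: 'k::field ^ 'n::finite}"
proof
  assume sp: "spans_line a b"
  have ab: "a \<noteq> b"
    using line_pt_eq_0_iff[OF sp, of "(1, -1)"] by (auto simp: line_pt_def)
  have "u a = 0 \<and> u b = 0" if "(\<Sum>v\<in>{a, b}. u v *s v) = 0" for u
    using that ab line_pt_eq_0_iff[OF sp, of "(u a, u b)"] by (simp add: line_pt_def)
  then show "a \<noteq> b \<and> vec.independent {a, b}"
    using ab by (auto simp: vec.dependent_finite)
next
  assume ab: "a \<noteq> b \<and> vec.independent {a, b}"
  show "spans_line a b"
    unfolding spans_line_def
  proof (intro allI impI)
    fix s assume "line_pt a b s = 0"
    then have "(\<Sum>v\<in>{a, b}. (if v = a then fst s else snd s) *s v) = 0"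
      using ab by (auto simp: line_pt_def)
    then have "(if v = a then fst s else snd s) = 0" if "v \<in> {a, b}" for v
      using ab that vec.independentD[of "{a, b}" "{a, b}" "\<lambda>v. if v = a then fst s else snd s" v] by simp
    from this[of a] this[of b] show "s = (0, 0)" using ab by (cases s) auto
  qed
qed

lemma span_pair: "vec.span {a, b} = range (line_pt a b)"
proof -
  have "x \<in> vec.span {a, b} \<longleftrightarrow> (\<exists>k l. x - k *s a = l *s b)" for x
    unfolding vec.span_insert[of a] vec.span_singleton by blast
  moreover have "(\<exists>k l. x - k *s a = l *s b) \<longleftrightarrow> (\<exists>k l. x = line_pt a b (k, l))" for x
    by (simp add: line_pt_def algebra_simps)
  ultimately show ?thesis by (simp add: set_eq_iff image_iff)
qed

lemma plines_iff:
  "L \<in> plines \<longleftrightarrow> (\<exists>a b :: 'k::field ^ 'n::finite. spans_line a b \<and> L = line_through a b)"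
proof
  assume "L \<in> plines"
  then obtain V where V: "vec.subspace V" "vec.dim V = 2" "L = {ppoint v | v. v \<in> V \<and> v \<noteq> 0}"
    by (auto simp: plines_def)
  obtain B where B: "B \<subseteq> V" "vec.independent B" "V \<subseteq> vec.span B" "card B = 2"
    using vec.basis_exists[of V] V(2) by metis
  then obtain a b where ab: "B = {a, b}" "a \<noteq> b" by (auto simp: card_2_iff)
  have "V = range (line_pt a b)"
    using vec.span_minimal[OF B(1) V(1)] B(3) ab span_pair by blast
  moreover have "spans_line a b" using B ab by (simp add: spans_line_iff)
  ultimately have "L = line_through a b"
    unfolding V(3) line_through_def using line_pt_eq_0_iff[of a b] by blast
  with \<open>spans_line a b\<close> show "\<exists>a b. spans_line a b \<and> L = line_through a b" by blast
next
  assume "\<exists>a b :: 'k ^ 'n. spans_line a b \<and> L = line_through a b"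
  then obtain a b :: "'k ^ 'n" where ab: "spans_line a b" "L = line_through a b" by blast
  have "vec.dim (vec.span {a, b}) = 2"
    using ab(1) by (simp add: spans_line_iff vec.dim_eq_card_independent)
  moreover have "L = {ppoint v | v. v \<in> vec.span {a, b} \<and> v \<noteq> 0}"
    unfolding ab(2) line_through_def span_pair using line_pt_eq_0_iff[OF ab(1)] by blast
  ultimately show "L \<in> plines"
    unfolding plines_def using vec.subspace_span by blast
qed

lemma wedge_line_pt: "wedge (line_pt a b s) (line_pt a b t) = bracket s t *s wedge a b"
  by (simp add: wedge_def vec_eq_iff line_pt_def bracket_def algebra_simps)

lemma line_pt_scale: "c *s line_pt a b s = line_pt a b (c * fst s, c * snd s)"
  by (simp add: line_pt_def vec_eq_iff algebra_simps)

lemma ppoint_scale: "c \<noteq> 0 \<Longrightarrow> ppoint (c *s v) = ppoint v"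
  unfolding ppoint_def
proof safe
  fix k :: 'a assume "c \<noteq> 0" "k \<noteq> 0"
  then show "\<exists>d. k *s (c *s v) = d *s v \<and> d \<noteq> 0" by (intro exI[of _ "k * c"]) simp
  show "\<exists>d. k *s v = d *s (c *s v) \<and> d \<noteq> 0"
    using \<open>c \<noteq> 0\<close> \<open>k \<noteq> 0\<close> by (intro exI[of _ "k / c"]) simp
qed

lemma ppoint_line_pt_eq_iff:
  assumes "spans_line a b" "s \<noteq> (0, 0)" "t \<noteq> (0, 0)"
  shows "ppoint (line_pt a b s) = ppoint (line_pt a b t) \<longleftrightarrow> bracket s t = 0"
proof
  assume "ppoint (line_pt a b s) = ppoint (line_pt a b t)"
  then obtain c where "line_pt a b s = c *s line_pt a b t"
    using self_in_ppoint[of "line_pt a b s"] by (auto simp: mem_ppoint)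
  then have "line_pt a b (fst s - c * fst t, snd s - c * snd t) = 0"
    by (simp add: line_pt_def vec_eq_iff algebra_simps)
  then have "fst s = c * fst t" "snd s = c * snd t"
    using assms(1) unfolding spans_line_def by fastforce+
  then show "bracket s t = 0" by (simp add: bracket_def)
next
  assume "bracket s t = 0"
  then obtain c where c: "s = (c * fst t, c * snd t)"
    using proportional_if_bracket_eq_0 assms(3) by blast
  then have "c \<noteq> 0" using assms(2) by auto
  then show "ppoint (line_pt a b s) = ppoint (line_pt a b t)"
    using ppoint_scale[of c "line_pt a b t"] by (simp add: line_pt_scale flip: c)
qed

lemma Union_line_through: "\<Union>(line_through a b) = line_pt a b ` (- {(0, 0)})"
proof
  show "\<Union>(line_through a b) \<subseteq> line_pt a b ` (- {(0, 0)})"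
  proof
    fix p assume "p \<in> \<Union>(line_through a b)"
    then obtain s where s: "s \<noteq> (0, 0)" "p \<in> ppoint (line_pt a b s)"
      unfolding line_through_def by blast
    then obtain c where "c \<noteq> 0" "p = c *s line_pt a b s" unfolding mem_ppoint by blast
    with s have "p = line_pt a b (c * fst s, c * snd s)" "(c * fst s, c * snd s) \<noteq> (0, 0)"
      by (auto simp: line_pt_scale prod_eq_iff)
    then show "p \<in> line_pt a b ` (- {(0, 0)})" by blast
  qed
  show "line_pt a b ` (- {(0, 0)}) \<subseteq> \<Union>(line_through a b)"
    using self_in_ppoint unfolding line_through_def by blast
qed

text \<open>The wedges of pairs of points are the
  multiples of \<open>wedge a b\<close> by nonzero brackets, and every nonzero scalar is a bracket.\<close>

lemma plucker_line_through:
  assumes "spans_line a b"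
  shows "plucker (line_through a b) = ppoint (wedge a b)"
proof -
  let ?p = "line_pt a b"
  have "plucker (line_through a b) =
      {wedge (?p s) (?p t) | s t. s \<noteq> (0, 0) \<and> t \<noteq> (0, 0) \<and> ppoint (?p s) \<noteq> ppoint (?p t)}"
    unfolding plucker_def Union_line_through by blast
  also have "\<dots> = {bracket s t *s wedge a b | s t. bracket s t \<noteq> 0}"
  proof -
    have "s \<noteq> (0, 0) \<and> t \<noteq> (0, 0) \<and> ppoint (?p s) \<noteq> ppoint (?p t) \<longleftrightarrow> bracket s t \<noteq> 0" for s t
    proof (cases "s = (0, 0) \<or> t = (0, 0)")
      case True
      then show ?thesis by (auto simp: bracket_def)
    next
      case False
      then show ?thesis using ppoint_line_pt_eq_iff[OF assms] by blast
    qed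
    then show ?thesis by (simp only: wedge_line_pt)
  qed
  also have "\<dots> = ppoint (wedge a b)"
  proof -
    have "c = bracket (c, 0) (0, 1)" for c :: 'a
      by (simp add: bracket_def)
    then show ?thesis unfolding ppoint_def by metis
  qed
  finally show ?thesis .
qed

text \<open>A choice of one coordinate pair for every point, so that the projective statement becomes one
  about pairwise nonproportional pairs.\<close>

lemma finite_subset_line_through:
  assumes ab: "spans_line a b" and X: "finite X" "X \<subseteq> line_through a b"
  obtains S where "finite S" "card S = card X" "(0, 0) \<notin> S" "pairwise (\<lambda>s t. bracket s t \<noteq> 0) S"
    "X = (\<lambda>s. ppoint (line_pt a b s)) ` S"
proof -
  have "\<forall>P\<in>X. \<exists>s. s \<noteq> (0, 0) \<and> P = ppoint (line_pt a b s)"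
    using X(2) unfolding line_through_def by blast
  then obtain r where r: "\<And>P. P \<in> X \<Longrightarrow> r P \<noteq> (0, 0)" "\<And>P. P \<in> X \<Longrightarrow> P = ppoint (line_pt a b (r P))"
    by metis
  have inj: "inj_on r X" using r(2) by (metis inj_onI)
  show thesis
  proof (rule that[of "r ` X"])
    show "pairwise (\<lambda>s t. bracket s t \<noteq> 0) (r ` X)"
    proof (rule pairwiseI)
      fix s t assume "s \<in> r ` X" "t \<in> r ` X" "s \<noteq> t"
      then obtain P Q where PQ: "P \<in> X" "Q \<in> X" "s = r P" "t = r Q" "P \<noteq> Q" by blast
      then have "ppoint (line_pt a b s) \<noteq> ppoint (line_pt a b t)" using r(2) by metis
      then show "bracket s t \<noteq> 0" using ppoint_line_pt_eq_iff[OF ab] r(1) PQ by metis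
    qed
    show "(0, 0) \<notin> r ` X" using r(1) by force
    show "X = (\<lambda>s. ppoint (line_pt a b s)) ` r ` X" 
      using r(2) by (auto simp: image_image)
  qed (use X(1) inj in \<open>auto simp: card_image\<close>)
qed

section \<open>The open set of generic pairs of lines\<close>

lemma biform_cross_ratio:
  "\<exists>f :: ((4 \<times> 4) + (4 \<times> 4), 'k::field) mpoly. biform f \<and>
     (\<forall>P Q. mpoly_eval f (case_sum (($) P) (($) Q)) = cross_ratio_form P Q)"
proof -
  let ?m = "\<lambda>i j k l. Poly_Mapping.single (Inl i) (1::nat) + Poly_Mapping.single (Inl j) 1
    + Poly_Mapping.single (Inr k) 1 + Poly_Mapping.single (Inr l) 1 :: ((4 \<times> 4) + (4 \<times> 4)) \<Rightarrow>\<^sub>0 nat"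
  let ?f = "Poly_Mapping.single (?m (1, 2) (3, 4) (1, 3) (2, 4)) 1 -
    Poly_Mapping.single (?m (1, 3) (2, 4) (1, 2) (3, 4)) (1::'k)"
  have deg: "(\<Sum>i'\<in>UNIV. Poly_Mapping.lookup (?m i j k l) (Inl i')) = 2"
    "(\<Sum>i'\<in>UNIV. Poly_Mapping.lookup (?m i j k l) (Inr i')) = 2" for i j k l
    by (simp_all add: lookup_add lookup_single when_def sum.distrib)
  have "biform ?f"
    unfolding biform_def
  proof (intro exI ballI)
    fix m assume "m \<in> Poly_Mapping.keys ?f"
    then have "m = ?m (1, 2) (3, 4) (1, 3) (2, 4) \<or> m = ?m (1, 3) (2, 4) (1, 2) (3, 4)"
      using keys_diff by (fastforce split: if_splits)
    then show "(\<Sum>i\<in>UNIV. Poly_Mapping.lookup m (Inl i)) = 2 \<and> (\<Sum>j\<in>UNIV. Poly_Mapping.lookup m (Inr j)) = 2"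
      using deg by metis
  qed
  moreover have "mpoly_eval ?f (case_sum (($) P) (($) Q)) = cross_ratio_form P Q" for P Q
    by (simp only: mpoly_eval_diff mpoly_eval_single monomial_eval_add monomial_eval_single
        cross_ratio_form_def sum.case mult_1_left)
  ultimately show ?thesis by blast
qed

definition generic_line_pairs :: "(('k::field, 4) ppoint set \<times> ('k, 4) ppoint set) set" where
  "generic_line_pairs = {(L, L') \<in> plines \<times> plines. plucker L \<in> pspace \<and> plucker L' \<in> pspace \<and>
     (\<forall>P\<in>plucker L. \<forall>Q\<in>plucker L'. cross_ratio_form P Q \<noteq> 0)}"

lemma openin_generic_line_pairs:
  "openin zariski_line_pairs (generic_line_pairs :: (('k::field, 4) ppoint set \<times> ('k, 4) ppoint set) set)"
proof -
  obtain f :: "((4 \<times> 4) + (4 \<times> 4), 'k) mpoly" where f: "biform f"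
    "\<And>P Q. mpoly_eval f (case_sum (($) P) (($) Q)) = cross_ratio_form P Q"
    using biform_cross_ratio by blast
  let ?D = "{(P, Q) \<in> pspace \<times> pspace. \<forall>p\<in>P. \<forall>q\<in>Q. mpoly_eval f (case_sum (($) p) (($) q)) \<noteq> 0}"
  have "openin zariski_prod ?D"
    unfolding zariski_prod_def by (rule topology_generated_by_Basis) (use f(1) in blast)
  moreover have "generic_line_pairs = map_prod plucker plucker -` ?D \<inter> plines \<times> plines"
    by (auto simp: generic_line_pairs_def f(2))
  ultimately show ?thesis
    unfolding zariski_line_pairs_def openin_pullback_topology by blast
qed

lemma cross_ratio_form_scale:
  "cross_ratio_form (c *s P) (d *s Q) = c ^ 2 * d ^ 2 * cross_ratio_form P Q"
  by (simp add: cross_ratio_form_def power2_eq_square algebra_simps)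

lemma generic_line_pairs_nonempty:
  "(generic_line_pairs :: (('k::field, 4) ppoint set \<times> ('k, 4) ppoint set) set) \<noteq> {}"
proof -
  \<comment> \<open>The bracket of the first and fourth coordinate pairs vanishes on the
      first line but not on the second, so the cross ratios differ; all coordinates are \<open>0\<close>
      or \<open>1\<close>, so this works in every characteristic.\<close>
  define a b a' b' :: "'k ^ 4" where
    "a = (\<chi> i. if i = 2 then 0 else 1)" and "b = (\<chi> i. if i = 2 \<or> i = 3 then 1 else 0)" and
    "a' = (\<chi> i. if i = 2 then 0 else 1)" and "b' = (\<chi> i. if i = 1 then 0 else 1)"
  have sp: "spans_line a b" "spans_line a' b'"
    by (auto simp: spans_line_def line_pt_def vec_eq_iff forall_4 a_def b_def a'_def b'_def prod_eq_iff)
  have D: "cross_ratio_form (wedge a b) (wedge a' b') \<noteq> 0"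
    by (simp add: cross_ratio_form_def wedge_nth a_def b_def a'_def b'_def)
  have "wedge a b \<noteq> 0" "wedge a' b' \<noteq> 0"
    using D by (auto simp: cross_ratio_form_def)
  then have "ppoint (wedge a b) \<in> pspace" "ppoint (wedge a' b') \<in> pspace"
    unfolding pspace_def by blast+
  moreover have "line_through a b \<in> plines" "line_through a' b' \<in> plines"
    using sp plines_iff by blast+
  moreover have "cross_ratio_form P Q \<noteq> 0"
    if "P \<in> ppoint (wedge a b)" "Q \<in> ppoint (wedge a' b')" for P Q
    using that D by (auto simp: mem_ppoint cross_ratio_form_scale)
  ultimately have "(line_through a b, line_through a' b') \<in> generic_line_pairs"
    unfolding generic_line_pairs_def by (simp add: plucker_line_through sp)
  then show ?thesis by blast
qed

lemma openin_zariski_line: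
  assumes "spans_line a b"
  shows "openin (subtopology zariski (line_through a b)) (line_through a b)"
proof -
  have "form (1 :: ('b, 'a) mpoly)" using homogeneous_1 form_iff_homogeneous by blast
  then have "openin zariski {P \<in> pspace. \<forall>p\<in>P. mpoly_eval (1 :: ('b, 'a) mpoly) (($) p) \<noteq> 0}"
    unfolding zariski_def by (intro topology_generated_by_Basis) blast
  moreover have "line_through a b \<subseteq> pspace"
    using assms by (auto simp: line_through_def pspace_def spans_line_def)
  ultimately show ?thesis
    unfolding openin_subtopology by (intro exI conjI) (assumption, auto)
qed

theorem corollary4p11:
  shows "\<exists>W :: (('k::alg_closed_field, 4) ppoint set \<times> ('k, 4) ppoint set) set.
    openin zariski_line_pairs W \<and> W \<noteq> {} \<and>
    (\<forall>L L'. (L, L') \<in> W \<and> L \<noteq> L' \<longrightarrow>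
      (\<exists>U. openin (subtopology zariski L) U \<and> U \<noteq> {} \<and>
        (\<forall>X. finite X \<and> X \<subseteq> U \<and> card X \<ge> 2 \<longrightarrow>
          (\<exists>U'. openin (subtopology zariski L') U' \<and> U' \<noteq> {} \<and>
            (\<forall>X'. finite X' \<and> X' \<subseteq> U' \<and> card X' = card X \<longrightarrow>
              \<not> complete_intersection (X \<star> X'))))))"
proof (intro exI[of _ generic_line_pairs] conjI allI impI)
  show "openin zariski_line_pairs generic_line_pairs" by (rule openin_generic_line_pairs)
  show "generic_line_pairs \<noteq> {}" by (rule generic_line_pairs_nonempty)
  fix L L' :: "('k, 4) ppoint set"
  assume "(L, L') \<in> generic_line_pairs \<and> L \<noteq> L'"
  then have LL': "L \<in> plines" "L' \<in> plines"
    "\<And>P Q. P \<in> plucker L \<Longrightarrow> Q \<in> plucker L' \<Longrightarrow> cross_ratio_form P Q \<noteq> 0"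
    by (auto simp: generic_line_pairs_def)
  obtain a b a' b' where ab: "spans_line a b" "L = line_through a b"
    and ab': "spans_line a' b'" "L' = line_through a' b'"
    using LL'(1,2) unfolding plines_iff by blast
  have "cross_ratio_form (wedge a b) (wedge a' b') \<noteq> 0"
    using LL'(3) unfolding ab(2) ab'(2) plucker_line_through[OF ab(1)] plucker_line_through[OF ab'(1)]
    by (simp add: self_in_ppoint)
  then have sep: "separates_lines a b a' b'" by (rule separates_lines_if_generic)
  have ne: "line_through c d \<noteq> {}" for c d :: "'k ^ 4"
    unfolding line_through_def by (simp, intro exI[of _ 1], simp)
  have not_ci: "\<not> complete_intersection (X \<star> X')"
    if X: "finite X" "X \<subseteq> L" "2 \<le> card X" and X': "finite X'" "X' \<subseteq> L'" "card X' = card X" for X X'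
  proof -
    obtain S where S: "finite S" "card S = card X" "(0, 0) \<notin> S"
      "pairwise (\<lambda>s t. bracket s t \<noteq> 0) S" "X = (\<lambda>s. ppoint (line_pt a b s)) ` S"
      using finite_subset_line_through[OF ab(1) X(1)] X(2) ab(2) by metis
    obtain T where T: "finite T" "card T = card X'" "(0, 0) \<notin> T"
      "pairwise (\<lambda>s t. bracket s t \<noteq> 0) T" "X' = (\<lambda>t. ppoint (line_pt a' b' t)) ` T"
      using finite_subset_line_through[OF ab'(1) X'(1)] X'(2) ab'(2) by metis
    have "line_pt a b s * line_pt a' b' t \<noteq> 0" if "s \<in> S" "t \<in> T" for s t
      by (rule separates_lines_product_nonzero[OF sep]) (use that S(3) T(3) in auto)
    then show ?thesis
      unfolding S(5) T(5)
      by (intro grid_not_complete_intersection[OF infinite_UNIV_alg_closed sep])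
        (use S(1-4) T(1-4) X(3) X'(3) in auto)
  qed
  show "\<exists>U. openin (subtopology zariski L) U \<and> U \<noteq> {} \<and>
        (\<forall>X. finite X \<and> X \<subseteq> U \<and> card X \<ge> 2 \<longrightarrow>
          (\<exists>U'. openin (subtopology zariski L') U' \<and> U' \<noteq> {} \<and>
            (\<forall>X'. finite X' \<and> X' \<subseteq> U' \<and> card X' = card X \<longrightarrow>
              \<not> complete_intersection (X \<star> X'))))"
    using openin_zariski_line[OF ab(1)] openin_zariski_line[OF ab'(1)] ne not_ci
    unfolding ab(2) ab'(2) by (intro exI conjI allI impI) (assumption, blast+)
qed

end
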